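(* $(\{P \mid \mathbf{CRF}(P)=P\}, \sqcap, \mathit{false}, \mathbin{;}, \mathrm{II}_c, \star)$ forms a weak Kleene algebra.
   Context: Reactive relations are fixed points of $\mathbf{RR}(P) \triangleq \exists (ok, ok', wait, wait') \bullet \mathbf{R1}(\mathbf{R2}(P))$, where $\mathbf{R1}(P) \triangleq P \land tr \le tr'$ and $\mathbf{R2}(P) \triangleq P[\langle\rangle, tr'-tr/tr, tr'] \triangleleft tr \le tr' \triangleright P$. Stateful-failure reactive finalisers are fixed points of $\mathbf{CRF}(P) \triangleq \exists (ref, ref') \bullet \mathbf{RR}(P)$ (no reference to the refusal variables). The identity is $\mathrm{II}_c \triangleq (st' = st \land tr' = tr)$. Nondeterministic choice $\sqcap$ is disjunction, $\mathbin{;}$ is relational composition, and the star is $P^{\star} \triangleq \mathrm{II}_c \sqcap \bigvee_{i\in\mathbb{N}} P^{i+1}$. A weak Kleene algebra $(K,+,0,\cdot,1,\star)$ is one where $(K,+,0)$ is an idempotent commutative monoid, $(K,\cdot,1)$ is a monoid, $\cdot$ distributes over $+$ on both sides, $0$ is a left annihilator, and (with $x\le y \iff x+y=y$) $1 + x\cdot x^\star \le x^\star$, $z + x\cdot y \le y \implies x^\star\cdot z \le y$, $z + y\cdot x \le y \implies z\cdot x^\star \le y$. *)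

theory Defs
  imports "HOL-Algebra.Ring" "HOL-Library.Sublist"
begin

section \<open>Weak Kleene algebras\<close>

record 'a kleene = "'a ring" +
  kstar :: "'a \<Rightarrow> 'a"

definition kle :: "('a, 'm) ring_scheme \<Rightarrow> 'a \<Rightarrow> 'a \<Rightarrow> bool" (infix "\<preceq>\<index>" 50)
  where "x \<preceq>\<^bsub>K\<^esub> y \<longleftrightarrow> x \<oplus>\<^bsub>K\<^esub> y = y"

text \<open>Zero is required to be a left annihilator only, so the semiring locale of the
  library is too strong here.\<close>

locale weak_kleene_algebra = abelian_monoid K + monoid K
  for K :: "('a, 'm) kleene_scheme" (structure) +
  assumes add_idem: "x \<in> carrier K \<Longrightarrow> x \<oplus> x = x"
    and l_distrib: "\<lbrakk>x \<in> carrier K; y \<in> carrier K; z \<in> carrier K\<rbrakk>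
      \<Longrightarrow> (x \<oplus> y) \<otimes> z = (x \<otimes> z) \<oplus> (y \<otimes> z)"
    and r_distrib: "\<lbrakk>x \<in> carrier K; y \<in> carrier K; z \<in> carrier K\<rbrakk>
      \<Longrightarrow> z \<otimes> (x \<oplus> y) = (z \<otimes> x) \<oplus> (z \<otimes> y)"
    and l_annihil: "x \<in> carrier K \<Longrightarrow> \<zero> \<otimes> x = \<zero>"
    and star_closed: "x \<in> carrier K \<Longrightarrow> kstar K x \<in> carrier K"
    and star_unfold: "x \<in> carrier K \<Longrightarrow> \<one> \<oplus> (x \<otimes> kstar K x) \<preceq> kstar K x"
    and star_inductl: "\<lbrakk>x \<in> carrier K; y \<in> carrier K; z \<in> carrier K; z \<oplus> (x \<otimes> y) \<preceq> y\<rbrakk>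
      \<Longrightarrow> kstar K x \<otimes> z \<preceq> y"
    and star_inductr: "\<lbrakk>x \<in> carrier K; y \<in> carrier K; z \<in> carrier K; z \<oplus> (y \<otimes> x) \<preceq> y\<rbrakk>
      \<Longrightarrow> z \<otimes> kstar K x \<preceq> y"

section \<open>Reactive relations and finalisers\<close>

text \<open>The record fields are the observational variables; a relation is a predicate on the
  undashed and the dashed observation, so that substitution is record update.\<close>

record ('s, 'e) obs =
  ok :: bool
  wait :: bool
  tr :: "'e list"
  st :: 's
  ref :: "'e set"

type_synonym ('s, 'e) rrel = "('s, 'e) obs \<Rightarrow> ('s, 'e) obs \<Rightarrow> bool"

text \<open>\<open>trace_diff t' t\<close> is the difference \<open>t' - t\<close>; it is meaningful only when \<open>t\<close> is a prefix of \<open>t'\<close>.\<close>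

definition trace_diff :: "'e list \<Rightarrow> 'e list \<Rightarrow> 'e list"
  where
    "trace_diff t' t = drop (length t) t'"

definition R1 :: "('s, 'e) rrel \<Rightarrow> ('s, 'e) rrel"
  where "R1 P = (\<lambda>s s'. P s s' \<and> prefix (tr s) (tr s'))"

definition R2 :: "('s, 'e) rrel \<Rightarrow> ('s, 'e) rrel"
  where "R2 P = (\<lambda>s s'.
    if prefix (tr s) (tr s')
    then P (s\<lparr>tr := []\<rparr>) (s'\<lparr>tr := trace_diff (tr s') (tr s)\<rparr>)
    else P s s')"

definition RR :: "('s, 'e) rrel \<Rightarrow> ('s, 'e) rrel"
  where "RR P = (\<lambda>s s'. \<exists>o\<^sub>0 o\<^sub>1 w\<^sub>0 w\<^sub>1.
    R1 (R2 P) (s\<lparr>ok := o\<^sub>0, wait := w\<^sub>0\<rparr>) (s'\<lparr>ok := o\<^sub>1, wait := w\<^sub>1\<rparr>))"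

definition CRF :: "('s, 'e) rrel \<Rightarrow> ('s, 'e) rrel"
  where "CRF P = (\<lambda>s s'. \<exists>r\<^sub>0 r\<^sub>1. RR P (s\<lparr>ref := r\<^sub>0\<rparr>) (s'\<lparr>ref := r\<^sub>1\<rparr>))"

definition II_c :: "('s, 'e) rrel"
  where "II_c = (\<lambda>s s'. st s' = st s \<and> tr s' = tr s)"

definition rstar :: "('s, 'e) rrel \<Rightarrow> ('s, 'e) rrel"
  where "rstar P = sup II_c (SUP i::nat. P ^^ (i + 1))"

end

theory Submission
  imports Defs
begin

text \<open>A relation is CRF-healthy iff it relates \<open>s\<close> to \<open>s'\<close> through some relation \<open>Q\<close> between the
  initial state, the list of events appended to the trace, and the final state. Sequential
  composition concatenates these lists and \<open>II_c\<close> appends nothing, so healthy relations are closed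
  under all the operators and have \<open>II_c\<close> as a unit. The star laws follow from the
  distribution of composition over arbitrary joins and induction on the exponent.\<close>

definition trace_rel :: "('s \<Rightarrow> 'e list \<Rightarrow> 's \<Rightarrow> bool) \<Rightarrow> ('s, 'e) rrel"
  where "trace_rel Q = (\<lambda>s s'. \<exists>t. tr s' = tr s @ t \<and> Q (st s) t (st s'))"

text \<open>\<open>R1\<close> rules out the \<open>else\<close> branch of \<open>R2\<close>, so
  \<open>P\<close> is evaluated at initial trace \<open>[]\<close> and final trace \<open>t\<close>,
  the appended events. The quantifiers in \<open>RR\<close> and \<open>CRF\<close> hide
  \<open>ok\<close>, \<open>wait\<close> and \<open>ref\<close>, which leaves only \<open>st\<close>
  and \<open>t\<close> visible.\<close>

lemma CRF_eq_trace_rel: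
  fixes P :: "('s, 'e) rrel"
  shows "CRF P = trace_rel (\<lambda>x t y. \<exists>r0 r1 o0 o1 w0 w1.
    P \<lparr>ok = o0, wait = w0, tr = [], st = x, ref = r0\<rparr>
      \<lparr>ok = o1, wait = w1, tr = t, st = y, ref = r1\<rparr>)"
proof (intro ext)
  fix s s' :: "('s, 'e) obs"
  obtain a b c d e a' b' c' d' e' where
    "s = \<lparr>ok = a, wait = b, tr = c, st = d, ref = e\<rparr>"
    "s' = \<lparr>ok = a', wait = b', tr = c', st = d', ref = e'\<rparr>"
    by (metis obs.cases)
  then show "CRF P s s' = trace_rel (\<lambda>x t y. \<exists>r0 r1 o0 o1 w0 w1.
    P \<lparr>ok = o0, wait = w0, tr = [], st = x, ref = r0\<rparr>
      \<lparr>ok = o1, wait = w1, tr = t, st = y, ref = r1\<rparr>) s s'"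
    by (auto simp: CRF_def RR_def R1_def R2_def trace_rel_def trace_diff_def prefix_def
      cong: conj_cong) blast+
qed

lemma CRF_trace_rel: "CRF (trace_rel Q) = trace_rel Q"
  by (simp add: CRF_eq_trace_rel) (simp add: trace_rel_def)

text \<open>Reduces closure under composition and joins to exhibiting a representing
  \<open>Q\<close>.\<close>

lemma CRF_fixed_iff: "CRF P = P \<longleftrightarrow> P \<in> range trace_rel"
proof
  assume "CRF P = P"
  moreover have "CRF P \<in> range trace_rel"
    unfolding CRF_eq_trace_rel by (rule rangeI)
  ultimately show "P \<in> range trace_rel"
    by simp
qed (auto simp: CRF_trace_rel)

lemma II_c_eq_trace_rel: "II_c = trace_rel (\<lambda>x t y. t = [] \<and> y = x)"
  by (auto simp: II_c_def trace_rel_def fun_eq_iff)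

lemma trace_rel_relcompp:
  "trace_rel Q OO trace_rel R =
    trace_rel (\<lambda>x t y. \<exists>u v z. t = u @ v \<and> Q x u z \<and> R z v y)"
proof (intro ext iffI)
  fix s s'
  assume "trace_rel (\<lambda>x t y. \<exists>u v z. t = u @ v \<and> Q x u z \<and> R z v y) s s'"
  then obtain u v z where "tr s' = tr s @ u @ v" "Q (st s) u z" "R z v (st s')"
    by (auto simp: trace_rel_def)
  \<comment> \<open>The midpoint is fixed by its trace and state alone; \<open>ok\<close>,
    \<open>wait\<close> and \<open>ref\<close> are copied from \<open>s\<close>, since
    \<open>trace_rel\<close> ignores them.\<close>
  then have "trace_rel Q s (s\<lparr>tr := tr s @ u, st := z\<rparr>)"
    "trace_rel R (s\<lparr>tr := tr s @ u, st := z\<rparr>) s'"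
    by (auto simp: trace_rel_def)
  then show "(trace_rel Q OO trace_rel R) s s'" ..
qed (fastforce simp: trace_rel_def)

lemma CRF_II_c: "CRF II_c = II_c"
  by (simp add: II_c_eq_trace_rel CRF_trace_rel)

lemma CRF_bot: "CRF bot = bot"
  by (simp add: CRF_eq_trace_rel) (simp add: trace_rel_def fun_eq_iff)

lemma CRF_relcompp: "CRF P = P \<Longrightarrow> CRF Q = Q \<Longrightarrow> CRF (P OO Q) = P OO Q"
  by (auto simp: CRF_fixed_iff trace_rel_relcompp)

lemma CRF_sup: "CRF P = P \<Longrightarrow> CRF Q = Q \<Longrightarrow> CRF (sup P Q) = sup P Q"
proof -
  have "sup (trace_rel A) (trace_rel B) = trace_rel (\<lambda>x t y. A x t y \<or> B x t y)"
    for A B :: "'a \<Rightarrow> 'b list \<Rightarrow> 'a \<Rightarrow> bool"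
    by (auto simp: trace_rel_def fun_eq_iff)
  then show "CRF P = P \<Longrightarrow> CRF Q = Q \<Longrightarrow> CRF (sup P Q) = sup P Q"
    by (auto simp: CRF_fixed_iff)
qed

lemma CRF_SUP:
  assumes "\<And>i. i \<in> I \<Longrightarrow> CRF (P i) = P i"
  shows "CRF (SUP i\<in>I. P i) = (SUP i\<in>I. P i)"
proof -
  have "\<forall>i\<in>I. \<exists>Q. P i = trace_rel Q"
    using assms by (auto simp: CRF_fixed_iff)
  then obtain Q where Q: "\<forall>i\<in>I. P i = trace_rel (Q i)"
    by (rule bchoice[THEN exE])
  have "(SUP i\<in>I. P i) = trace_rel (\<lambda>x t y. \<exists>i\<in>I. Q i x t y)"
    by (auto simp: Q fun_eq_iff) (auto simp: trace_rel_def)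
  then show ?thesis
    by (simp add: CRF_trace_rel)
qed

text \<open>Only positive powers are healthy in general: \<open>P ^^ 0\<close> is equality, which
  also constrains \<open>ok\<close>, \<open>wait\<close> and \<open>ref\<close>. In
  \<open>rstar\<close> its place is taken by \<open>II_c\<close>.\<close>

lemma CRF_relpowp_Suc: "CRF P = P \<Longrightarrow> CRF (P ^^ Suc i) = P ^^ Suc i"
  by (induction i) (simp_all add: CRF_relcompp eq_OO)

lemma CRF_rstar: "CRF P = P \<Longrightarrow> CRF (rstar P) = rstar P"
  unfolding rstar_def
  by (intro CRF_sup CRF_II_c CRF_SUP) (simp add: CRF_relpowp_Suc del: relpowp.simps)

text \<open>\<open>II_c\<close> leaves \<open>ok\<close>, \<open>wait\<close> and \<open>ref\<close>
  free, so it is a left unit only where \<open>P\<close> ignores their initial values, as healthy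
  relations do.\<close>

lemma II_c_relcompp: "CRF P = P \<Longrightarrow> II_c OO P = P"
  by (auto simp: CRF_fixed_iff II_c_eq_trace_rel trace_rel_relcompp)

lemma relcompp_II_c: "CRF P = P \<Longrightarrow> P OO II_c = P"
  by (auto simp: CRF_fixed_iff II_c_eq_trace_rel trace_rel_relcompp)

lemma rstar_unfold:
  assumes "CRF P = P"
  shows "sup II_c (P OO rstar P) \<le> rstar P"
proof -
  have "P OO P ^^ Suc i \<le> rstar P" for i
  proof -
    \<comment> \<open>\<open>relpowp\<close> adds the new factor on the right, so \<open>P\<close>
      has to be commuted past the power.\<close>
    have "P OO P ^^ Suc i = P ^^ (Suc i + 1)"
      by (metis Suc_eq_plus1 relpowp.simps(2) relpowp_commute)
    also have "\<dots> \<le> rstar P"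
      unfolding rstar_def by (intro le_supI2 SUP_upper UNIV_I)
    finally show ?thesis .
  qed
  moreover have "P ^^ (0 + 1) \<le> rstar P"
    unfolding rstar_def by (intro le_supI2 SUP_upper UNIV_I)
  then have "P \<le> rstar P"
    by (simp add: eq_OO)
  \<comment> \<open>Distributing over the join, the \<open>II_c\<close> summand yields
    \<open>P\<close> and each power moves up by one.\<close>
  moreover have "P OO rstar P = sup P (SUP i. P OO P ^^ Suc i)"
    by (simp add: rstar_def relcompp_SUP_distrib relcompp_II_c assms
        del: relpowp.simps)
  ultimately show ?thesis
    by (auto simp: rstar_def intro: SUP_least simp del: relpowp.simps)
qed

text \<open>The hypothesis says that \<open>Q\<close> contains \<open>R\<close> and absorbs
  \<open>P\<close> on the left; the copies of \<open>P\<close> are absorbed one at a time.\<close>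

lemma relpowp_Suc_inductl:
  assumes "sup R (P OO Q) \<le> Q"
  shows "P ^^ Suc i OO R \<le> Q"
proof (induction i)
  case 0
  have "P OO R \<le> P OO Q"
    using assms by (intro relcompp_mono) auto
  also have "\<dots> \<le> Q"
    using assms by simp
  finally show ?case
    by (simp add: eq_OO)
next
  case (Suc i)
  have "P ^^ Suc (Suc i) OO R = P OO (P ^^ Suc i OO R)"
    by (metis relcompp_assoc relpowp.simps(2) relpowp_commute)
  also have "\<dots> \<le> P OO Q"
    using Suc by (intro relcompp_mono) auto
  also have "\<dots> \<le> Q"
    using assms by simp
  finally show ?case .
qed

lemma relpowp_Suc_inductr:
  assumes "sup R (Q OO P) \<le> Q"
  shows "R OO P ^^ Suc i \<le> Q"
proof (induction i)
  case 0
  have "R OO P \<le> Q OO P"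
    using assms by (intro relcompp_mono) auto
  also have "\<dots> \<le> Q"
    using assms by simp
  finally show ?case
    by (simp add: eq_OO)
next
  case (Suc i)
  have "R OO P ^^ Suc (Suc i) = (R OO P ^^ Suc i) OO P"
    by (simp add: relcompp_assoc)
  also have "\<dots> \<le> Q OO P"
    using Suc by (intro relcompp_mono) auto
  also have "\<dots> \<le> Q"
    using assms by simp
  finally show ?case .
qed

text \<open>Health of \<open>R\<close> lets the \<open>II_c\<close> summand of the star contribute
  exactly \<open>R\<close>; the positive powers are bounded one by one.\<close>

lemma rstar_inductl:
  assumes "CRF R = R" and "sup R (P OO Q) \<le> Q"
  shows "rstar P OO R \<le> Q"
proof -
  have "rstar P OO R = sup R (SUP i. P ^^ Suc i OO R)"
    by (simp add: rstar_def relcompp_SUP_distrib2 II_c_relcompp assms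
        del: relpowp.simps)
  also have "\<dots> \<le> Q"
    using assms(2) by (intro le_supI SUP_least relpowp_Suc_inductl) auto
  finally show ?thesis .
qed

lemma rstar_inductr:
  assumes "CRF R = R" and "sup R (Q OO P) \<le> Q"
  shows "R OO rstar P \<le> Q"
proof -
  have "R OO rstar P = sup R (SUP i. R OO P ^^ Suc i)"
    by (simp add: rstar_def relcompp_SUP_distrib relcompp_II_c assms
        del: relpowp.simps)
  also have "\<dots> \<le> Q"
    using assms(2) by (intro le_supI SUP_least relpowp_Suc_inductr) auto
  finally show ?thesis .
qed

theorem theorem13:
  "weak_kleene_algebra
    \<lparr>carrier = {P :: ('s, 'e) rrel. CRF P = P},
     mult = (OO), one = II_c, zero = bot, add = sup, kstar = rstar\<rparr>"
  (is "weak_kleene_algebra ?K")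
proof -
  have kle: "P \<preceq>\<^bsub>?K\<^esub> Q \<longleftrightarrow> P \<le> Q" for P Q
    by (simp add: kle_def le_iff_sup)
  show ?thesis
    \<comment> \<open>The simplifier splits \<open>sup a b \<le> c\<close> into a conjunction, so
      \<open>rstar_unfold\<close> is brought into the same split form to match the goal.\<close>
    by unfold_locales
      (simp_all add: kle sup_aci relcompp_assoc II_c_relcompp relcompp_II_c
        CRF_sup CRF_bot CRF_relcompp CRF_II_c CRF_rstar rstar_inductl rstar_inductr
        rstar_unfold[simplified])
qed

end
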